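(* Let $n$ be a positive integer. Then \[ \sum_{k=0}^{n-1}\frac{(q;q^9)_k^2\,(q^7;q^9)_k\, q^{9k}}{(q^9;q^9)_k^3}\equiv 0 \pmod{\Phi_n(q)^2}\quad\text{if } n\equiv 2,8\pmod 9, \] \[ \sum_{k=0}^{n-1}\frac{(q^2;q^9)_k^2\,(q^5;q^9)_k\, q^{9k}}{(q^9;q^9)_k^3}\equiv 0 \pmod{\Phi_n(q)^2}\quad\text{if } n\equiv 4,7\pmod 9, \] \[ \sum_{k=0}^{n-1}\frac{(q^4;q^9)_k^2\,(q;q^9)_k\, q^{9k}}{(q^9;q^9)_k^3}\equiv 0 \pmod{\Phi_n(q)^2}\quad\text{if } n\equiv 5,8\pmod 9. \]
   Context: $(a;q)_k=(1-a)(1-aq)\cdots(1-aq^{k-1})$ (with $(a;q)_0=1$) is the $q$-shifted factorial; $\Phi_n(q)$ is the $n$-th cyclotomic polynomial. A congruence of a rational function in $q$ modulo a polynomial $P(q)$, where the denominator is coprime to $P(q)$, means that $P(q)$ divides the numerator (in the ring of Laurent polynomials in $q$ with rational coefficients). *)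

theory Defs
  imports "HOL-Computational_Algebra.Computational_Algebra"
begin

definition qfact :: "'a::comm_ring_1 \<Rightarrow> 'a \<Rightarrow> nat \<Rightarrow> 'a" where
  "qfact a q k = (\<Prod>i<k. 1 - a * q ^ i)"

definition prim_roots_unity :: "nat \<Rightarrow> complex set" where
  "prim_roots_unity n = {z. z ^ n = 1 \<and> (\<forall>m. 0 < m \<and> m < n \<longrightarrow> z ^ m \<noteq> 1)}"

text \<open>
  The product over the primitive roots lives in \<open>\<complex>[q]\<close>; the cyclotomic polynomial is its unique
  preimage in \<open>\<rat>[q]\<close>. That the preimage exists is shown in \<open>map_poly_cyclotomic\<close> below.
\<close>
definition cyclotomic :: "nat \<Rightarrow> rat poly" where
  "cyclotomic n = (THE p. map_poly of_rat p = (\<Prod>z\<in>prim_roots_unity n. [:- z, 1:]))"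

lemma map_poly_of_rat_mult:
  "map_poly of_rat (p * q) = (map_poly of_rat p * map_poly of_rat q :: complex poly)"
  by (intro poly_eqI) (simp add: coeff_map_poly coeff_mult of_rat_sum of_rat_mult)

lemma map_poly_of_rat_add:
  "map_poly of_rat (p + q) = (map_poly of_rat p + map_poly of_rat q :: complex poly)"
  by (intro poly_eqI) (simp add: coeff_map_poly of_rat_add)

lemma map_poly_of_rat_prod:
  "map_poly of_rat (\<Prod>x\<in>A. f x) = (\<Prod>x\<in>A. map_poly of_rat (f x) :: complex poly)"
  by (induction A rule: infinite_finite_induct) (simp_all add: map_poly_of_rat_mult)

lemma map_poly_of_rat_eq_iff:
  "map_poly of_rat p = (map_poly of_rat q :: complex poly) \<longleftrightarrow> p = q"
  by (auto simp: poly_eq_iff coeff_map_poly)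

lemma finite_prim_roots_unity: "n > 0 \<Longrightarrow> finite (prim_roots_unity n)"
  by (rule finite_subset[OF _ finite_roots_unity[of n]]) (auto simp: prim_roots_unity_def)

lemma prod_roots_unity:
  assumes "n > 0"
  shows "(\<Prod>z | z ^ n = 1. [:- z, 1:]) = (monom 1 n - 1 :: complex poly)"
proof -
  let ?S = "{z :: complex. z ^ n = 1}"
  have fin: "finite ?S" and card: "card ?S = n"
    using assms by (auto intro: finite_roots_unity card_roots_unity_eq)
  let ?P = "\<Prod>z\<in>?S. [:- z, 1:]" and ?Q = "monom 1 n - 1 :: complex poly"
  show ?thesis
  proof (rule poly_eqI_degree_lead_coeff[where A = ?S and n = n])
    show "degree ?P \<le> n"
      using card by (subst degree_prod_eq_sum_degree) auto
    show "degree ?Q \<le> n"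
      by (intro degree_diff_le) (auto simp: degree_monom_le)
    have "degree ?P = n"
      using card by (subst degree_prod_eq_sum_degree) auto
    moreover have "lead_coeff ?P = 1" by (simp add: lead_coeff_prod)
    ultimately show "coeff ?P n = coeff ?Q n" using assms by simp
    show "poly ?P z = poly ?Q z" if "z \<in> ?S" for z
      using that fin by (auto simp: poly_prod poly_monom)
  qed (use card in auto)
qed

lemma roots_unity_eq_UN:
  assumes "n > 0"
  shows "{z. z ^ n = 1} = (\<Union>d\<in>{d. d dvd n}. prim_roots_unity d)"
proof (intro equalityI subsetI)
  fix z :: complex assume z: "z \<in> {z. z ^ n = 1}"
  define d where "d = (LEAST d. d > 0 \<and> z ^ d = 1)"
  have d: "d > 0 \<and> z ^ d = 1"
    unfolding d_def by (rule LeastI[of _ n]) (use assms z in auto)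
  have least: "\<not> (0 < m \<and> z ^ m = 1)" if "m < d" for m
    using not_less_Least that unfolding d_def by blast
  have "z ^ n = (z ^ d) ^ (n div d) * z ^ (n mod d)"
    by (metis mult_div_mod_eq power_add power_mult)
  hence "z ^ (n mod d) = 1" using d z by simp
  hence "n mod d = 0" using least[of "n mod d"] d by auto
  thus "z \<in> (\<Union>d\<in>{d. d dvd n}. prim_roots_unity d)"
    using d least by (auto simp: prim_roots_unity_def)
next
  fix z assume "z \<in> (\<Union>d\<in>{d. d dvd n}. prim_roots_unity d)"
  thus "z \<in> {z. z ^ n = 1}"
    by (auto simp: prim_roots_unity_def power_mult elim!: dvdE)
qed

lemma prod_cyclotomic_complex:
  assumes "n > 0"
  shows "(\<Prod>d | d dvd n. \<Prod>z\<in>prim_roots_unity d. [:- z, 1:]) = (monom 1 n - 1 :: complex poly)"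
proof -
  have pos: "d > 0" if "d dvd n" for d using that assms by (auto intro: Nat.gr0I)
  have "(\<Prod>z\<in>(\<Union>d\<in>{d. d dvd n}. prim_roots_unity d). [:- z, 1:]) =
        (\<Prod>d | d dvd n. \<Prod>z\<in>prim_roots_unity d. [:- z, 1:])"
  proof (rule prod.UNION_disjoint)
    show "\<forall>i\<in>{d. d dvd n}. \<forall>j\<in>{d. d dvd n}. i \<noteq> j \<longrightarrow> prim_roots_unity i \<inter> prim_roots_unity j = {}"
      using pos unfolding prim_roots_unity_def by (auto, metis linorder_neqE_nat)
  qed (use assms pos finite_prim_roots_unity in auto)
  thus ?thesis using prod_roots_unity[OF assms] roots_unity_eq_UN[OF assms] by simp
qed

lemma ex_cyclotomic:
  "n > 0 \<Longrightarrow> \<exists>p :: rat poly. map_poly of_rat p = (\<Prod>z\<in>prim_roots_unity n. [:- z, 1:])"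
proof (induction n rule: less_induct)
  case (less n)
  define F :: "nat \<Rightarrow> complex poly" where "F d = (\<Prod>z\<in>prim_roots_unity d. [:- z, 1:])" for d
  let ?D = "{d. d dvd n} - {n}"
  have fin: "finite {d. d dvd n}" using less.prems by simp
  have "\<exists>p. map_poly of_rat p = F d" if "d \<in> ?D" for d
    unfolding F_def
  proof (rule less.IH)
    have "d dvd n" "d \<noteq> n" using that by auto
    thus "d < n" "d > 0" using less.prems by (auto dest: dvd_imp_le intro: Nat.gr0I)
  qed
  then obtain f :: "nat \<Rightarrow> rat poly" where f: "\<And>d. d \<in> ?D \<Longrightarrow> map_poly of_rat (f d) = F d"
    by metis
  define D where "D = (\<Prod>d\<in>?D. f d)"
  have D: "map_poly of_rat D = (\<Prod>d\<in>?D. F d)"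
    unfolding D_def map_poly_of_rat_prod using f by (intro prod.cong) auto
  have "lead_coeff (F d) = 1" for d
    by (simp add: F_def lead_coeff_prod)
  hence "lead_coeff (map_poly of_rat D :: complex poly) = 1"
    unfolding D by (simp add: lead_coeff_prod)
  hence D0: "map_poly of_rat D \<noteq> (0 :: complex poly)" by auto
  define N :: "rat poly" where "N = monom 1 n - 1"
  have "(\<Prod>d | d dvd n. F d) = F n * (\<Prod>d\<in>?D. F d)"
    using fin by (intro prod.remove) auto
  moreover have "map_poly of_rat N = (monom 1 n - 1 :: complex poly)"
    by (intro poly_eqI) (simp add: N_def coeff_map_poly of_rat_diff)
  ultimately have N: "map_poly of_rat N = F n * map_poly of_rat D"
    using prod_cyclotomic_complex[OF less.prems] by (simp add: F_def D)
  have "map_poly of_rat N = map_poly of_rat (N div D) * map_poly of_rat D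
          + (map_poly of_rat (N mod D) :: complex poly)"
    by (metis div_mult_mod_eq map_poly_of_rat_add map_poly_of_rat_mult)
  hence eq: "map_poly of_rat (N mod D) = (F n - map_poly of_rat (N div D)) * map_poly of_rat D"
    using N by (simp add: algebra_simps)
  have degmap: "degree (map_poly of_rat p :: complex poly) = degree p" for p :: "rat poly"
    by (rule degree_map_poly) auto
  have "F n - map_poly of_rat (N div D) = 0"
  proof (rule ccontr)
    assume nz: "F n - map_poly of_rat (N div D) \<noteq> 0"
    have "degree (N mod D) \<ge> degree D"
      using arg_cong[OF eq, of degree] nz D0 by (simp add: degmap degree_mult_eq)
    moreover have "N mod D \<noteq> 0" using eq nz D0 by auto
    moreover have "D \<noteq> 0" using D0 by auto
    ultimately show False using degree_mod_less[of D N] by auto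
  qed
  thus ?case unfolding F_def by (metis eq_iff_diff_eq_0)
qed

lemma map_poly_cyclotomic:
  assumes "n > 0"
  shows "map_poly of_rat (cyclotomic n) = (\<Prod>z\<in>prim_roots_unity n. [:- z, 1:])"
  unfolding cyclotomic_def
  by (rule theI') (use ex_cyclotomic[OF assms] in \<open>metis map_poly_of_rat_eq_iff\<close>)

text \<open>
  Rational functions are elements of the field of fractions of \<open>\<rat>[q]\<close>, and the ring of Laurent
  polynomials \<open>\<rat>[q, q\<^sup>-\<^sup>1]\<close> is the subring of those of the form \<open>p / q\<^sup>m\<close>. Divisibility
  and coprimality are relative to that subring; in the field itself they would be vacuous.
\<close>

definition qvar :: "rat poly fract" where
  "qvar = to_fract [:0, 1:]"

definition laurent_polys :: "rat poly fract set" where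
  "laurent_polys = {to_fract p / qvar ^ m | p m. True}"

definition laurent_dvd :: "rat poly fract \<Rightarrow> rat poly fract \<Rightarrow> bool" where
  "laurent_dvd A B \<longleftrightarrow> (\<exists>C\<in>laurent_polys. B = A * C)"

definition laurent_coprime :: "rat poly fract \<Rightarrow> rat poly fract \<Rightarrow> bool" where
  "laurent_coprime A B \<longleftrightarrow>
     (\<forall>D\<in>laurent_polys. laurent_dvd D A \<longrightarrow> laurent_dvd D B \<longrightarrow> laurent_dvd D 1)"

definition ratfun_cong :: "rat poly fract \<Rightarrow> rat poly fract \<Rightarrow> rat poly \<Rightarrow> bool" where
  "ratfun_cong f g P \<longleftrightarrow>
     (\<exists>A\<in>laurent_polys. \<exists>B\<in>laurent_polys.
        B \<noteq> 0 \<and> f - g = A / B \<and> laurent_coprime B (to_fract P) \<and>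
        laurent_dvd (to_fract P) A)"

end

theory Submission
  imports Defs "HOL-Computational_Algebra.Field_as_Ring"
begin

text \<open>
  Write the exponents as \<open>r\<close>, \<open>r\<close>, \<open>d - 2 r\<close> with base \<open>Q = q\<^sup>d\<close>, and choose \<open>t\<close> with
  \<open>t n = r + d N\<close>. With \<open>u = q\<^bsup>t n\<^esup>\<close>, so that \<open>u\<close> is \<open>1\<close> modulo \<open>\<Phi>\<^sub>n\<close>, replacing
  \<open>(q\<^sup>r; Q)\<^sub>k\<^sup>2\<close> by \<open>(q\<^sup>r u; Q)\<^sub>k (q\<^sup>r / u; Q)\<^sub>k\<close> changes each summand only modulo \<open>\<Phi>\<^sub>n\<^sup>2\<close>.
  As \<open>q\<^sup>r / u\<close> is the power of \<open>Q\<close> with exponent \<open>-N\<close>, the new sum is a terminating balanced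
  series, which the q-Saalschuetz formula evaluates as a quotient of q-shifted factorials. The
  denominator is coprime to \<open>\<Phi>\<^sub>n\<close>, and for \<open>N < n \<le> 2 N\<close> each of the two q-shifted
  factorials in the numerator has a factor divisible by \<open>\<Phi>\<^sub>n\<close>.
\<close>

section \<open>Gaussian binomial coefficients and q-shifted factorials\<close>

text \<open>The Gaussian binomial coefficient, given by a q-Pascal rule so that it makes sense in
  any commutative ring. The truncated exponent \<open>n - k\<close> is harmless: for
  \<open>n < k\<close> its cofactor is 0.\<close>

fun qbinom :: "'a::comm_ring_1 \<Rightarrow> nat \<Rightarrow> nat \<Rightarrow> 'a" where
  "qbinom q n 0 = 1"
| "qbinom q 0 (Suc k) = 0"
| "qbinom q (Suc n) (Suc k) = qbinom q n (Suc k) + q ^ (n - k) * qbinom q n k"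

lemma qbinom_eq_0: "n < k \<Longrightarrow> qbinom q n k = 0"
  by (induction q n k rule: qbinom.induct) auto

text \<open>The ratio of neighbouring coefficients, free of division. The q-Pascal rule reduces it
  to two instances one row above.\<close>

lemma qbinom_Suc_right:
  "k \<le> n \<Longrightarrow> qbinom q n (Suc k) * (1 - q ^ Suc k) = qbinom q n k * (1 - q ^ (n - k))"
proof (induction n arbitrary: k)
  case (Suc n)
  have last: "qbinom q n (Suc k) * (1 - q ^ Suc k) = qbinom q n k * (1 - q ^ (n - k))" for k
    using Suc.IH[of k] by (cases "k \<le> n") (auto simp: qbinom_eq_0)
  show ?case
  proof (cases k)
    case 0
    have "qbinom q (Suc n) 1 * (1 - q) = qbinom q n 1 * (1 - q) + q ^ n * (1 - q)"
      by (simp add: algebra_simps)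
    also have "\<dots> = 1 - q ^ Suc n"
      using Suc.IH[of 0] by (simp add: algebra_simps)
    finally show ?thesis by (simp add: 0)
  next
    case k: (Suc j)
    define A B C where "A = qbinom q n (Suc (Suc j))" and "B = qbinom q n (Suc j)"
      and "C = qbinom q n j"
    show ?thesis
    proof (cases "Suc j \<le> n")
      case True
      then obtain i where n: "n = Suc j + i" using le_Suc_ex by blast
      have 1: "A * (1 - q * (q * q ^ j)) = B * (1 - q ^ i)"
        and 2: "B * (1 - q * q ^ j) = C * (1 - q * q ^ i)"
        using last[of "Suc j"] last[of j] by (simp_all add: n A_def B_def C_def)
      have "n - Suc j = i" "n - j = Suc i" using n by simp_all
      hence "qbinom q (Suc n) (Suc k) * (1 - q ^ Suc k) - qbinom q (Suc n) k * (1 - q ^ (Suc n - k))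
          = (A + q ^ i * B) * (1 - q * (q * q ^ j)) - (B + q * q ^ i * C) * (1 - q * q ^ i)"
        by (simp add: k A_def B_def C_def)
      \<comment> \<open>Both brackets vanish by 1 and 2.\<close>
      also have "\<dots> = (A * (1 - q * (q * q ^ j)) - B * (1 - q ^ i))
          + q * q ^ i * (B * (1 - q * q ^ j) - C * (1 - q * q ^ i))"
        by (simp add: algebra_simps)
      finally show ?thesis using 1 2 by simp
    next
      case False
      thus ?thesis using Suc.prems k by (simp add: qbinom_eq_0)
    qed
  qed
qed simp

lemma qfact_0 [simp]: "qfact a q 0 = 1"
  by (simp add: qfact_def)

lemma qfact_Suc: "qfact a q (Suc k) = qfact a q k * (1 - a * q ^ k)"
  by (simp add: qfact_def)

lemma qfact_add: "qfact a q (j + k) = qfact a q j * qfact (a * q ^ j) q k"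
  by (induction k) (simp_all add: qfact_Suc power_add mult_ac)

lemma qfact_Suc_left: "qfact a q (Suc k) = (1 - a) * qfact (a * q) q k"
  using qfact_add[of a q 1 k] by (simp add: qfact_Suc)

lemma qbinom_mult_qfact:
  "k \<le> n \<Longrightarrow> qbinom q n k * qfact q q k = qfact (q * q ^ (n - k)) q k"
proof (induction k)
  case (Suc k)
  have "qbinom q n (Suc k) * qfact q q (Suc k)
      = qbinom q n (Suc k) * (1 - q ^ Suc k) * qfact q q k"
    by (simp add: qfact_Suc mult_ac)
  also have "\<dots> = (1 - q ^ (n - k)) * (qbinom q n k * qfact q q k)"
    using Suc.prems by (subst qbinom_Suc_right) (simp_all add: mult_ac)
  also have "\<dots> = (1 - q ^ (n - k)) * qfact (q ^ (n - k) * q) q k"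
    using Suc by (simp add: mult_ac)
  also have "\<dots> = qfact (q * q ^ (n - Suc k)) q (Suc k)"
    using Suc.prems by (simp add: qfact_Suc_left Suc_diff_Suc flip: power_Suc)
  finally show ?case .
qed simp

section \<open>The q-Saalschuetz summation\<close>

text \<open>
  The q-Saalschuetz formula with denominators cleared and \<open>c = a b e\<close>. Summands for \<open>N + 1\<close>
  and \<open>N\<close> differ by a telescoping \<open>H\<close>, the certificate found by the WZ method.
\<close>
lemma qfact_saalschuetz_poly:
  fixes a b e q :: "'a::comm_ring_1"
  shows "(\<Sum>k\<le>N. qbinom q N k * qfact a q k * qfact b q k * qfact e q (N - k) * e ^ k
            * qfact (a * b * e * q ^ k) q (N - k)) = qfact (a * e) q N * qfact (b * e) q N"
proof (induction N)
  case (Suc N)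
  define c where "c = a * b * e"
  define T where "T N k = qbinom q N k * qfact a q k * qfact b q k * qfact e q (N - k) * e ^ k
            * qfact (c * q ^ k) q (N - k)" for N k
  define H where "H k = q ^ (N - k) * qbinom q N k * qfact a q (Suc k) * qfact b q (Suc k)
            * qfact e q (N - k) * e ^ Suc k * qfact (c * q ^ k) q (N - k)" for k
  define x where "x = (1 - a * e * q ^ N) * (1 - b * e * q ^ N)"
  \<comment> \<open>The telescoping relation at its lower end, where no earlier value of
    \<open>H\<close> occurs.\<close>
  have first: "T (Suc N) 0 = x * T N 0 - H 0"
  proof -
    define F where "F = qfact e q N * qfact c q N"
    have "T (Suc N) 0 = F * (1 - e * q ^ N) * (1 - c * q ^ N)" "T N 0 = F"
      "H 0 = q ^ N * (1 - a) * (1 - b) * e * F"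
      by (simp_all add: T_def H_def F_def qfact_Suc mult_ac)
    thus ?thesis unfolding x_def c_def by (simp add: algebra_simps)
  qed
  have step: "T (Suc N) (Suc k) = x * T N (Suc k) - (H (Suc k) - H k)" if "k < N" for k
  proof -
    obtain i where N: "N = Suc k + i" using \<open>k < N\<close> less_eq_Suc_le le_Suc_ex by metis
    \<comment> \<open>\<open>M\<close> divides all four terms. What remains is a polynomial identity
      that holds modulo the relation between the neighbours \<open>B\<close> and
      \<open>B'\<close>.\<close>
    define B B' M y z where "B = qbinom q N k" and "B' = qbinom q N (Suc k)"
      and "M = qfact a q (Suc k) * qfact b q (Suc k) * qfact e q i * e ^ Suc k
              * qfact (c * q ^ Suc k) q i"
      and "y = q ^ k" and "z = q ^ i"
    have B: "B' * (1 - q * y) = B * (1 - q * z)"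
      using qbinom_Suc_right[of k N q] by (simp add: N B_def B'_def y_def z_def)
    have T1: "T (Suc N) (Suc k) = (B' + q * z * B) * M * (1 - e * z) * (1 - c * q * y * z)"
      by (simp add: T_def B_def B'_def M_def y_def z_def qfact_Suc N power_add mult_ac)
    have T2: "T N (Suc k) = B' * M"
      by (simp add: T_def B'_def M_def N mult_ac)
    have H1: "H (Suc k) = z * B' * M * (1 - a * q * y) * (1 - b * q * y) * e"
      by (simp add: H_def B'_def M_def N y_def z_def qfact_Suc[of _ _ "Suc k"] mult_ac)
    have H2: "H k = q * z * B * M * (1 - e * z) * (1 - c * y)"
      using qfact_Suc_left[of "c * q ^ k" q i]
      by (simp add: H_def B_def M_def N y_def z_def qfact_Suc[of e] mult_ac)
    have x: "x = (1 - a * e * q * y * z) * (1 - b * e * q * y * z)"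
      by (simp add: x_def N y_def z_def power_add mult_ac)
    have "T (Suc N) (Suc k) - (x * T N (Suc k) - (H (Suc k) - H k))
        = q * z * M * (1 - e * z) * c * y * (B * (1 - q * z) - B' * (1 - q * y))"
      unfolding T1 T2 H1 H2 x by (simp add: c_def algebra_simps)
    thus ?thesis using B by simp
  qed
  have last: "T (Suc N) (Suc N) = H N"
    by (simp add: T_def H_def qbinom_eq_0)
  have "(\<Sum>k\<le>Suc N. T (Suc N) k) = T (Suc N) 0 + (\<Sum>k<N. T (Suc N) (Suc k)) + H N"
    by (subst sum.atMost_Suc_shift) (simp add: last lessThan_Suc_atMost[symmetric])
  also have "\<dots> = x * T N 0 - H 0 + (\<Sum>k<N. x * T N (Suc k) - (H (Suc k) - H k)) + H N"
    using step by (simp add: first)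
  also have "\<dots> = x * (T N 0 + (\<Sum>k<N. T N (Suc k)))"
    by (simp only: sum_subtractf[of "\<lambda>k. x * T N (Suc k)"] sum_lessThan_telescope)
      (simp add: sum_distrib_left algebra_simps)
  also have "T N 0 + (\<Sum>k<N. T N (Suc k)) = (\<Sum>k\<le>N. T N k)"
    using sum.lessThan_Suc_shift[of "T N" N] by (simp add: lessThan_Suc_atMost)
  also have "\<dots> = qfact (a * e) q N * qfact (b * e) q N"
    using Suc.IH by (simp add: T_def c_def)
  finally show ?case
    by (simp add: T_def c_def x_def qfact_Suc mult_ac)
qed simp

text \<open>Taking the factors in reverse order and pulling \<open>- x * q ^ (N - Suc i)\<close> out
  of each inverts the argument. This moves between products ending at index \<open>N\<close> and
  products of length \<open>k\<close>.\<close>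

lemma qfact_reverse:
  fixes x q :: "'a::field"
  assumes "x \<noteq> 0" "q \<noteq> 0" "k \<le> N"
  shows "qfact (x * q ^ (N - k)) q k
       = x ^ k * (\<Prod>i<k. - (q ^ (N - Suc i))) * qfact (q / (q ^ N * x)) q k"
proof -
  have "qfact (x * q ^ (N - k)) q k = (\<Prod>i<k. 1 - x * q ^ (N - Suc i))"
    unfolding qfact_def
    using \<open>k \<le> N\<close> by (subst prod.nat_diff_reindex[symmetric])
      (auto intro!: prod.cong simp: mult.assoc simp flip: power_add)
  also have "\<dots> = (\<Prod>i<k. x * - (q ^ (N - Suc i)) * (1 - q / (q ^ N * x) * q ^ i))"
  proof (rule prod.cong)
    fix i assume "i \<in> {..<k}"
    then obtain j where "N = Suc i + j" using assms(3) le_Suc_ex[of "Suc i" N] by auto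
    thus "1 - x * q ^ (N - Suc i) = x * - (q ^ (N - Suc i)) * (1 - q / (q ^ N * x) * q ^ i)"
      using assms by (simp add: field_simps power_add)
  qed simp
  also have "\<dots> = x ^ k * (\<Prod>i<k. - (q ^ (N - Suc i))) * qfact (q / (q ^ N * x)) q k"
    by (simp only: prod.distrib qfact_def) simp
  finally show ?thesis .
qed

text \<open>The classical summation of a balanced terminating series, with
  \<open>c * d = a * b * q / q ^ N\<close>. It is the polynomial form divided termwise by
  \<open>qfact c q N * qfact e q N\<close>.\<close>

lemma q_saalschuetz:
  fixes a b c d e q :: "'a::field"
  assumes "q \<noteq> 0" "e \<noteq> 0" "c = a * b * e" "d = q / (q ^ N * e)"
    and "qfact q q N \<noteq> 0" "qfact c q N \<noteq> 0" "qfact e q N \<noteq> 0"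
  shows "(\<Sum>k\<le>N. qfact a q k * qfact b q k * qfact (inverse (q ^ N)) q k * q ^ k
            / (qfact q q k * qfact c q k * qfact d q k))
       = qfact (a * e) q N * qfact (b * e) q N / (qfact c q N * qfact e q N)"
proof -
  have "qfact a q k * qfact b q k * qfact (inverse (q ^ N)) q k * q ^ k
            / (qfact q q k * qfact c q k * qfact d q k)
      = qbinom q N k * qfact a q k * qfact b q k * qfact e q (N - k) * e ^ k
            * qfact (a * b * e * q ^ k) q (N - k) / (qfact c q N * qfact e q N)"
    if "k \<le> N" for k
  proof -
    \<comment> \<open>Reversal is used twice, at \<open>x = q\<close> for the binomial and at
      \<open>x = e\<close> for the lower parameter \<open>d\<close>; the factor \<open>w\<close> is
      common to both and cancels.\<close>
    define w where "w = (\<Prod>i<k. - (q ^ (N - Suc i)))"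
    have w: "w \<noteq> 0" using assms(1) by (simp add: w_def)
    have q: "qfact q q N = qfact q q k * qfact (q * q ^ k) q (N - k)"
      and c: "qfact c q N = qfact c q k * qfact (c * q ^ k) q (N - k)"
      and e: "qfact e q N = qfact e q (N - k) * qfact (e * q ^ (N - k)) q k"
      using qfact_add[of q q k "N - k"] qfact_add[of c q k "N - k"] qfact_add[of e q "N - k" k] that
      by simp_all
    have "qbinom q N k * qfact q q k = q ^ k * w * qfact (inverse (q ^ N)) q k"
      using qbinom_mult_qfact[OF that, of q] qfact_reverse[OF assms(1,1) that] assms(1)
      by (simp add: w_def field_simps)
    hence bin: "qbinom q N k = q ^ k * w * qfact (inverse (q ^ N)) q k / qfact q q k"
      using assms(5) q by (auto simp: field_simps)
    have rev: "qfact (e * q ^ (N - k)) q k = e ^ k * w * qfact d q k"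
      using qfact_reverse[OF assms(2,1) that] by (simp add: w_def assms(4))
    show ?thesis
      using assms(1,2,5-7) w unfolding c e q rev bin assms(3)[symmetric] by (simp add: field_simps)
  qed
  thus ?thesis
    by (simp add: qfact_saalschuetz_poly flip: sum_divide_distrib)
qed

section \<open>Localisation at a polynomial\<close>

text \<open>Localising the polynomial ring at the elements coprime to \<open>P\<close> gives a ring,
  the case \<open>j = 0\<close>, in which this is the ideal generated by \<open>P ^ j\<close>.
  Congruences of rational functions become membership.\<close>

definition loc_ideal :: "rat poly \<Rightarrow> nat \<Rightarrow> rat poly fract set" where
  "loc_ideal P j = {to_fract (P ^ j * p) / to_fract s | p s. s \<noteq> 0 \<and> coprime s P}"

lemma loc_idealI:
  "s \<noteq> 0 \<Longrightarrow> coprime s P \<Longrightarrow> x = to_fract (P ^ j * p) / to_fract s \<Longrightarrow> x \<in> loc_ideal P j"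
  unfolding loc_ideal_def by blast

lemma loc_idealE:
  assumes "x \<in> loc_ideal P j"
  obtains p s where "s \<noteq> 0" "coprime s P" "x = to_fract (P ^ j * p) / to_fract s"
  using assms unfolding loc_ideal_def by blast

lemma to_fract_in_loc_ideal: "to_fract (P ^ j * p) \<in> loc_ideal P j"
  by (rule loc_idealI[where s = 1 and p = p]) auto

lemma loc_ideal_0 [simp]: "0 \<in> loc_ideal P j"
  using to_fract_in_loc_ideal[of P j 0] by simp

lemma loc_ideal_1 [simp]: "1 \<in> loc_ideal P 0"
  using to_fract_in_loc_ideal[of P 0 1] by simp

lemma loc_ideal_add:
  assumes "x \<in> loc_ideal P j" "y \<in> loc_ideal P j"
  shows "x + y \<in> loc_ideal P j"
proof -
  obtain p s where x: "s \<noteq> 0" "coprime s P" "x = to_fract (P ^ j * p) / to_fract s"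
    using assms(1) by (rule loc_idealE)
  obtain p' s' where y: "s' \<noteq> 0" "coprime s' P" "y = to_fract (P ^ j * p') / to_fract s'"
    using assms(2) by (rule loc_idealE)
  show ?thesis
    unfolding x(3) y(3) using x(1,2) y(1,2)
    by (intro loc_idealI[where s = "s * s'" and p = "p * s' + p' * s"])
      (auto simp: field_simps coprime_mult_left_iff)
qed

lemma loc_ideal_mult:
  assumes "x \<in> loc_ideal P i" "y \<in> loc_ideal P j"
  shows "x * y \<in> loc_ideal P (i + j)"
proof -
  obtain p s where x: "s \<noteq> 0" "coprime s P" "x = to_fract (P ^ i * p) / to_fract s"
    using assms(1) by (rule loc_idealE)
  obtain p' s' where y: "s' \<noteq> 0" "coprime s' P" "y = to_fract (P ^ j * p') / to_fract s'"
    using assms(2) by (rule loc_idealE)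
  show ?thesis
    unfolding x(3) y(3) using x(1,2) y(1,2)
    by (intro loc_idealI[where s = "s * s'" and p = "p * p'"])
      (auto simp: power_add coprime_mult_left_iff)
qed

lemma loc_ideal_mult_left:
  "x \<in> loc_ideal P 0 \<Longrightarrow> y \<in> loc_ideal P j \<Longrightarrow> x * y \<in> loc_ideal P j"
  using loc_ideal_mult[of x P 0 y j] by simp

lemma loc_ideal_mult_right:
  "x \<in> loc_ideal P j \<Longrightarrow> y \<in> loc_ideal P 0 \<Longrightarrow> x * y \<in> loc_ideal P j"
  using loc_ideal_mult[of x P j y 0] by simp

lemma loc_ideal_uminus:
  "x \<in> loc_ideal P j \<Longrightarrow> - x \<in> loc_ideal P j"
  using loc_ideal_mult_left[of "-1" P x j] to_fract_in_loc_ideal[of P 0 "-1"] by simp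

lemma loc_ideal_diff:
  "x \<in> loc_ideal P j \<Longrightarrow> y \<in> loc_ideal P j \<Longrightarrow> x - y \<in> loc_ideal P j"
  using loc_ideal_add[OF _ loc_ideal_uminus, of x P j y] by simp

lemma loc_ideal_sum:
  "(\<And>i. i \<in> A \<Longrightarrow> f i \<in> loc_ideal P j) \<Longrightarrow> sum f A \<in> loc_ideal P j"
  by (induction A rule: infinite_finite_induct) (auto intro: loc_ideal_add)

lemma loc_ideal_prod:
  "(\<And>i. i \<in> A \<Longrightarrow> f i \<in> loc_ideal P 0) \<Longrightarrow> prod f A \<in> loc_ideal P 0"
  by (induction A rule: infinite_finite_induct) (auto intro: loc_ideal_mult_left)

lemma loc_ideal_power: "x \<in> loc_ideal P 0 \<Longrightarrow> x ^ k \<in> loc_ideal P 0"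
  by (induction k) (auto intro: loc_ideal_mult_left)

lemma loc_ideal_qfact:
  assumes "a \<in> loc_ideal P 0" "q \<in> loc_ideal P 0"
  shows "qfact a q k \<in> loc_ideal P 0"
  unfolding qfact_def
  using assms by (intro loc_ideal_prod loc_ideal_diff loc_ideal_mult_left loc_ideal_power) auto

text \<open>
  \<open>u + 1 / u - 2 = (u - 1)\<^sup>2 / u\<close>, so deforming a square symmetrically by \<open>u\<close> changes it
  only to second order.
\<close>
lemma qfact_square_cong:
  assumes "x \<in> loc_ideal P 0" "q \<in> loc_ideal P 0" "u \<noteq> 0"
    "u \<in> loc_ideal P 0" "inverse u \<in> loc_ideal P 0" "1 - u \<in> loc_ideal P 1"
  shows "qfact x q k ^ 2 - qfact (x * u) q k * qfact (x * inverse u) q k \<in> loc_ideal P 2"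
proof (induction k)
  case (Suc k)
  define A B f g where "A = qfact x q k" and "B = qfact (x * u) q k * qfact (x * inverse u) q k"
    and "f = 1 - x * q ^ k" and "g = (1 - x * u * q ^ k) * (1 - x * inverse u * q ^ k)"
  have "B \<in> loc_ideal P 0" "f \<in> loc_ideal P 0"
    unfolding B_def f_def using assms
    by (auto intro!: loc_ideal_mult_left loc_ideal_qfact loc_ideal_diff loc_ideal_power)
  moreover have "f ^ 2 - g = x * q ^ k * inverse u * ((1 - u) * (1 - u))"
    using assms(3) by (simp add: f_def g_def field_simps power2_eq_square)
  moreover have "x * q ^ k * inverse u * ((1 - u) * (1 - u)) \<in> loc_ideal P 2"
    using assms loc_ideal_mult[OF assms(6,6)]
    by (intro loc_ideal_mult_left[of "_ * inverse u"] loc_ideal_mult_left[where j = 0] loc_ideal_power)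
      (auto simp: numeral_2_eq_2)
  moreover have "A ^ 2 - B \<in> loc_ideal P 2"
    using Suc.IH by (simp add: A_def B_def)
  \<comment> \<open>The first summand is small by induction, the second because one new factor
    changes only to second order.\<close>
  ultimately have "(A ^ 2 - B) * f ^ 2 + B * (f ^ 2 - g) \<in> loc_ideal P 2"
    by (intro loc_ideal_add loc_ideal_mult_right[of _ _ _ "f ^ 2"] loc_ideal_mult_left[of B] loc_ideal_power) auto
  also have "(A ^ 2 - B) * f ^ 2 + B * (f ^ 2 - g) = qfact x q (Suc k) ^ 2
      - qfact (x * u) q (Suc k) * qfact (x * inverse u) q (Suc k)"
    by (simp add: A_def B_def f_def g_def qfact_Suc power2_eq_square algebra_simps)
  finally show ?case .
qed simp

section \<open>Divisibility and coprimality for cyclotomic polynomials\<close>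

lemma degree_map_poly_of_rat [simp]: "degree (map_poly of_rat p :: complex poly) = degree p"
  by (rule degree_map_poly) auto

text \<open>A nonconstant common divisor has a complex root, and the roots of
  \<open>cyclotomic n\<close> are the primitive ones.\<close>

lemma coprime_cyclotomicI:
  assumes "n > 0" "p \<noteq> 0"
    and "\<And>z. z \<in> prim_roots_unity n \<Longrightarrow> poly (map_poly of_rat p) z \<noteq> 0"
  shows "coprime p (cyclotomic n)"
proof (rule coprimeI)
  fix g assume g: "g dvd p" "g dvd cyclotomic n"
  show "is_unit g"
  proof (rule ccontr)
    assume "\<not> is_unit g"
    moreover have "g \<noteq> 0" using g assms(2) by auto
    ultimately have "degree g \<noteq> 0" by (simp add: is_unit_iff_degree)
    hence "\<not> constant (poly (map_poly of_rat g :: complex poly))"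
      by (simp add: constant_degree)
    then obtain z :: complex where z: "poly (map_poly of_rat g) z = 0"
      using fundamental_theorem_of_algebra by blast
    have root: "poly (map_poly of_rat h) z = 0" if "g dvd h" for h
      using that z by (auto simp: map_poly_of_rat_mult elim!: dvdE)
    have "z \<in> prim_roots_unity n"
      using root[OF g(2)] assms(1)
      by (auto simp: map_poly_cyclotomic poly_prod finite_prim_roots_unity)
    thus False using assms(3) root[OF g(1)] by blast
  qed
qed

lemma prim_root_unity_power_eq_1D:
  assumes "n > 0" "z \<in> prim_roots_unity n" "z ^ m = 1"
  shows "n dvd m"
proof -
  have "z ^ m = (z ^ n) ^ (m div n) * z ^ (m mod n)"
    by (metis mult_div_mod_eq power_add power_mult)
  hence "z ^ (m mod n) = 1" using assms by (simp add: prim_roots_unity_def)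
  moreover have "m mod n < n" using assms(1) by simp
  ultimately have "m mod n = 0" using assms(2) by (auto simp: prim_roots_unity_def)
  thus ?thesis by auto
qed

lemma map_poly_of_rat_monom_minus_1:
  "map_poly of_rat (monom 1 m - 1) = (monom 1 m - 1 :: complex poly)"
  by (intro poly_eqI) (simp add: coeff_map_poly of_rat_diff)

text \<open>The complex factorisation over the divisors of \<open>m\<close> descends to the
  rationals, as the embedding is injective. For \<open>m = 0\<close> the right-hand side is
  0.\<close>

lemma cyclotomic_dvd_monom_minus_1:
  assumes "n dvd m"
  shows "cyclotomic n dvd monom 1 m - 1"
proof (cases "m = 0")
  case False
  hence pos: "e > 0" if "e dvd m" for e using that by (auto intro: Nat.gr0I)
  have "map_poly of_rat (\<Prod>e | e dvd m. cyclotomic e)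
      = (map_poly of_rat (monom 1 m - 1) :: complex poly)"
    unfolding map_poly_of_rat_monom_minus_1 map_poly_of_rat_prod
    using False pos by (subst prod_cyclotomic_complex[symmetric]) (auto simp: map_poly_cyclotomic)
  hence "(\<Prod>e | e dvd m. cyclotomic e) = monom 1 m - 1"
    by (simp only: map_poly_of_rat_eq_iff)
  moreover have "cyclotomic n dvd (\<Prod>e | e dvd m. cyclotomic e)"
    using assms False by (intro dvd_prodI) auto
  ultimately show ?thesis by simp
qed simp

lemma coprime_monom_minus_1_cyclotomic:
  assumes "n > 0" "\<not> n dvd m"
  shows "coprime (monom 1 m - 1) (cyclotomic n)"
proof (rule coprime_cyclotomicI)
  show "monom 1 m - 1 \<noteq> (0 :: rat poly)"
  proof
    assume "monom 1 m - 1 = (0 :: rat poly)"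
    hence "degree (monom (1 :: rat) m) = degree (1 :: rat poly)" by simp
    thus False using assms(2) by (simp add: degree_monom_eq)
  qed
  show "poly (map_poly of_rat (monom 1 m - 1)) z \<noteq> 0" if "z \<in> prim_roots_unity n" for z
    unfolding map_poly_of_rat_monom_minus_1
    using prim_root_unity_power_eq_1D[OF assms(1) that] assms(2) by (auto simp: poly_monom)
qed fact

section \<open>Powers of q in the localisation at a cyclotomic polynomial\<close>

lemma qvar_power: "qvar ^ m = to_fract (monom 1 m)"
  by (induction m) (simp_all add: qvar_def monom_Suc flip: to_fract_mult)

lemma qvar_nonzero [simp]: "qvar \<noteq> 0"
  by (simp add: qvar_def)

context
  fixes n :: nat
  assumes n: "n > 0"
begin

lemma qvar_powi_in_loc_ideal: "qvar powi m \<in> loc_ideal (cyclotomic n) 0"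
proof -
  have "inverse qvar \<in> loc_ideal (cyclotomic n) 0"
  proof (rule loc_idealI[where s = "[:0, 1:]" and p = 1])
    show "coprime [:0, 1:] (cyclotomic n)"
    proof (rule coprime_cyclotomicI)
      fix z assume "z \<in> prim_roots_unity n"
      hence "z \<noteq> 0" using n by (auto simp: prim_roots_unity_def power_0_left)
      thus "poly (map_poly of_rat [:0, 1:]) z \<noteq> 0" by (simp add: map_poly_pCons)
    qed (use n in auto)
  qed (simp_all add: qvar_def inverse_eq_divide)
  moreover have "qvar \<in> loc_ideal (cyclotomic n) 0"
    using to_fract_in_loc_ideal[of "cyclotomic n" 0 "[:0, 1:]"] by (simp add: qvar_def)
  ultimately show ?thesis
    by (auto simp: power_int_def power_inverse[symmetric] intro: loc_ideal_power)
qed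

lemma one_minus_qvar_powi_in_loc_ideal:
  assumes "int n dvd m"
  shows "1 - qvar powi m \<in> loc_ideal (cyclotomic n) 1"
proof -
  have nat: "1 - qvar ^ k \<in> loc_ideal (cyclotomic n) 1" if k: "n dvd k" for k
  proof -
    obtain p where "monom 1 k - 1 = cyclotomic n * p"
      using cyclotomic_dvd_monom_minus_1[OF k] by (auto elim: dvdE)
    hence "qvar ^ k - 1 = to_fract (cyclotomic n ^ 1 * p)"
      by (simp add: qvar_power flip: to_fract_1 to_fract_diff to_fract_mult)
    thus ?thesis
      using loc_ideal_uminus[OF to_fract_in_loc_ideal[of "cyclotomic n" 1 p]] by (metis minus_diff_eq)
  qed
  show ?thesis
  proof (cases m)
    case (nonneg k)
    thus ?thesis using nat[of k] assms by simp
  next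
    case (neg k)
    \<comment> \<open>A negative exponent differs from the positive one by a unit only.\<close>
    have eq: "1 - qvar powi m = qvar powi m * - (1 - qvar ^ Suc k)"
      unfolding neg by (simp add: power_int_minus field_simps del: of_nat_Suc power_Suc)
    have "n dvd Suc k" using assms unfolding neg by (simp del: of_nat_Suc)
    thus ?thesis unfolding eq
      using nat[of "Suc k"] by (intro loc_ideal_mult_left loc_ideal_uminus qvar_powi_in_loc_ideal)
  qed
qed

lemma one_minus_qvar_powi_unit:
  assumes "\<not> int n dvd m"
  shows "1 - qvar powi m \<noteq> 0" "inverse (1 - qvar powi m) \<in> loc_ideal (cyclotomic n) 0"
proof -
  have nat: "1 - qvar ^ k \<noteq> 0 \<and> inverse (1 - qvar ^ k) \<in> loc_ideal (cyclotomic n) 0"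
    if "\<not> n dvd k" for k
  proof -
    define s :: "rat poly" where "s = 1 - monom 1 k"
    have s: "coprime s (cyclotomic n)"
      using coprime_monom_minus_1_cyclotomic[OF n that] coprime_minus_left_iff[of s "cyclotomic n"]
      by (simp add: s_def)
    have "s \<noteq> 0"
    proof
      assume "s = 0"
      hence "degree (1 :: rat poly) = degree (monom (1 :: rat) k)" by (simp add: s_def)
      thus False using that by (simp add: degree_monom_eq)
    qed
    moreover have "1 - qvar ^ k = to_fract s" by (simp add: s_def qvar_power)
    ultimately show ?thesis
      using s by (auto intro!: loc_idealI[where s = s and p = 1] simp: inverse_eq_divide)
  qed
  have "1 - qvar powi m \<noteq> 0 \<and> inverse (1 - qvar powi m) \<in> loc_ideal (cyclotomic n) 0"
  proof (cases m)
    case (nonneg k)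
    thus ?thesis using nat[of k] assms by simp
  next
    case (neg k)
    have eq: "1 - qvar powi m = qvar powi m * - (1 - qvar ^ Suc k)"
      unfolding neg by (simp add: power_int_minus field_simps del: of_nat_Suc power_Suc)
    have "inverse (1 - qvar powi m) = qvar powi (- m) * - inverse (1 - qvar ^ Suc k)"
      by (simp only: eq inverse_mult_distrib inverse_minus_eq power_int_minus)
    moreover have "\<not> n dvd Suc k" using assms unfolding neg by (simp del: of_nat_Suc)
    ultimately show ?thesis
      using nat[of "Suc k"] unfolding eq
      by (auto intro!: loc_ideal_mult_left loc_ideal_uminus qvar_powi_in_loc_ideal simp del: power_Suc)
  qed
  thus "1 - qvar powi m \<noteq> 0" "inverse (1 - qvar powi m) \<in> loc_ideal (cyclotomic n) 0" by auto
qed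

lemma qfact_qvar:
  "qfact (qvar powi m) (qvar ^ d) k = (\<Prod>i<k. 1 - qvar powi (m + int d * int i))"
  unfolding qfact_def by (simp add: power_int_add flip: power_mult of_nat_mult)

text \<open>Every factor is a unit of the localisation; this controls the denominators.\<close>

lemma qfact_qvar_unit:
  assumes "\<And>i. i < k \<Longrightarrow> \<not> int n dvd m + int d * int i"
  shows "qfact (qvar powi m) (qvar ^ d) k \<noteq> 0"
    "inverse (qfact (qvar powi m) (qvar ^ d) k) \<in> loc_ideal (cyclotomic n) 0"
  unfolding qfact_qvar using assms one_minus_qvar_powi_unit
  by (auto simp flip: prod_inversef intro!: loc_ideal_prod)

text \<open>One factor in the ideal suffices, since the others lie in the localisation.\<close>

lemma qfact_qvar_in_loc_ideal:
  assumes "i < k" "int n dvd m + int d * int i"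
  shows "qfact (qvar powi m) (qvar ^ d) k \<in> loc_ideal (cyclotomic n) 1"
proof -
  have "qfact (qvar powi m) (qvar ^ d) k = (1 - qvar powi (m + int d * int i)) *
          (\<Prod>j\<in>{..<k} - {i}. 1 - qvar powi (m + int d * int j))"
    unfolding qfact_qvar using assms(1) by (intro prod.remove) auto
  thus ?thesis
    using one_minus_qvar_powi_in_loc_ideal[OF assms(2)]
    by (auto intro!: loc_ideal_mult_right loc_ideal_prod loc_ideal_diff qvar_powi_in_loc_ideal)
qed

end

section \<open>From the localisation to congruences over Laurent polynomials\<close>

lemma ratfun_cong_0I:
  assumes "f \<in> loc_ideal P j"
  shows "ratfun_cong f 0 (P ^ j)"
proof -
  obtain p s where f: "s \<noteq> 0" "coprime s P" "f = to_fract (P ^ j * p) / to_fract s"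
    using assms by (rule loc_idealE)
  have laurent: "to_fract p \<in> laurent_polys" for p
    unfolding laurent_polys_def by (intro CollectI exI[of _ p] exI[of _ "0 :: nat"]) simp
  \<comment> \<open>Laurent divisibility is polynomial divisibility up to a power of q.\<close>
  have dvd: "\<exists>k. p dvd r * monom 1 k" if r: "laurent_dvd (to_fract p / qvar ^ m) (to_fract r)" for p r m
  proof -
    obtain c l where "to_fract r = to_fract p / qvar ^ m * (to_fract c / qvar ^ l)"
      using r unfolding laurent_dvd_def laurent_polys_def by blast
    hence "to_fract (r * monom 1 (m + l)) = to_fract (p * c)"
      by (simp add: field_simps power_add flip: qvar_power)
    thus ?thesis by (metis dvd_triv_left to_fract_eq_iff)
  qed
  have "laurent_coprime (to_fract s) (to_fract (P ^ j))"
    unfolding laurent_coprime_def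
  proof safe
    fix D assume "D \<in> laurent_polys"
      and D: "laurent_dvd D (to_fract s)" "laurent_dvd D (to_fract (P ^ j))"
    then obtain p m where Dp: "D = to_fract p / qvar ^ m" by (auto simp: laurent_polys_def)
    obtain k l where "p dvd s * monom 1 k" "p dvd P ^ j * monom 1 l"
      using dvd D unfolding Dp by blast
    \<comment> \<open>With the same monomial on both sides, coprimality of \<open>s\<close> and
      \<open>P ^ j\<close> leaves only that monomial as gcd. So \<open>D\<close> divides a power of
      q, a unit among Laurent polynomials.\<close>
    hence "p dvd s * monom 1 k * monom 1 l" "p dvd P ^ j * monom 1 l * monom 1 k"
      by (simp_all only: dvd_mult2)
    hence "p dvd gcd (s * monom 1 (k + l)) (P ^ j * monom 1 (k + l))"
      by (simp add: mult.assoc mult_monom add.commute)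
    also have "\<dots> = normalize (monom 1 (k + l))"
    proof -
      have "gcd s (P ^ j) = 1" using f(2) by (intro coprime_imp_gcd_eq_1) simp
      thus ?thesis by (simp add: gcd_mult_right gcd.commute)
    qed
    finally have "p dvd monom 1 (k + l)" by simp
    then obtain w where w: "monom 1 (k + l) = p * w" by (auto elim: dvdE)
    hence "p \<noteq> 0" by auto
    have "to_fract p * to_fract w = qvar ^ (k + l)" by (simp add: qvar_power w)
    hence "1 = D * (to_fract (w * monom 1 m) / qvar ^ (k + l))"
      by (simp add: Dp flip: qvar_power)
    thus "laurent_dvd D 1"
      unfolding laurent_dvd_def laurent_polys_def by blast
  qed
  moreover have "laurent_dvd (to_fract (P ^ j)) (to_fract (P ^ j * p))"
    unfolding laurent_dvd_def using laurent by (intro bexI[of _ "to_fract p"]) auto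
  ultimately have "to_fract s \<noteq> 0 \<and> f - 0 = to_fract (P ^ j * p) / to_fract s \<and>
      laurent_coprime (to_fract s) (to_fract (P ^ j)) \<and> laurent_dvd (to_fract (P ^ j)) (to_fract (P ^ j * p))"
    using f by simp
  thus ?thesis
    unfolding ratfun_cong_def using laurent by blast
qed

section \<open>The congruence for general base and exponents\<close>

text \<open>Coprimality and \<open>N < n\<close> keep the denominators prime to
  \<open>cyclotomic n\<close>. The bounds on \<open>N\<close> also put the indices
  \<open>2 * N - n\<close> and \<open>n - Suc N\<close>, where the numerator acquires its two
  cyclotomic factors, below \<open>N\<close>.\<close>

lemma ratfun_cong_sum_qfact:
  assumes n: "n > 0" and t: "t * n = r + d * N" and N: "N < n" "n \<le> 2 * N"
    and r: "2 * r \<le> d" and coprime: "coprime n d"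
  shows "ratfun_cong
     (\<Sum>k = 0..n - 1. qfact (qvar ^ r) (qvar ^ d) k ^ 2 * qfact (qvar ^ (d - 2 * r)) (qvar ^ d) k
        * qvar ^ (d * k) / qfact (qvar ^ d) (qvar ^ d) k ^ 3) 0 (cyclotomic n ^ 2)"
proof (rule ratfun_cong_0I)
  define Q u a b e where "Q = qvar ^ d" and "u = qvar ^ (t * n)" and "a = qvar ^ r * u"
    and "b = qvar ^ (d - 2 * r)" and "e = inverse (Q ^ N)"
  let ?I = "loc_ideal (cyclotomic n)"
  have pow: "qvar ^ k \<in> ?I 0" for k
    using qvar_powi_in_loc_ideal[OF n, of "int k"] by simp
  have nz: "Q \<noteq> 0" "u \<noteq> 0" "e \<noteq> 0" by (simp_all add: Q_def u_def e_def)
  have Q: "Q = qvar powi int d" and b: "b = qvar powi int (d - 2 * r)"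
    and e: "e = qvar powi - int (d * N)"
    by (simp_all only: Q_def b_def e_def power_int_of_nat power_int_minus power_mult)
  have "a = qvar ^ (2 * r) * Q ^ N"
    by (simp add: a_def u_def t Q_def mult_2 add.assoc flip: power_add power_mult)
  hence ae: "a * e = qvar powi int (2 * r)"
    using nz by (simp only: e_def power_int_of_nat) simp
  have be: "b * e = qvar powi (int d - 2 * int r - int d * int N)"
    unfolding b e using r by (simp add: of_nat_diff flip: power_int_add)
  \<comment> \<open>By the choice of \<open>t\<close>, the terminating parameter is also the partner
    of \<open>a\<close> in the symmetric deformation of \<open>qvar ^ r\<close>.\<close>
  have e': "e = qvar ^ r * inverse u"
    by (simp add: e_def u_def t Q_def power_add power_mult)
  have small: "\<not> int n dvd int d * int i" if "0 < i" "i < n" for i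
  proof
    assume "int n dvd int d * int i"
    hence "n dvd d * i" by (simp flip: of_nat_mult)
    hence "n dvd i" using coprime by (simp add: coprime_dvd_mult_right_iff)
    thus False using that by (auto dest: dvd_imp_le)
  qed
  have "\<not> int n dvd int d + int d * int i" if "i < n - 1" for i
    using small[of "Suc i"] that by (simp add: algebra_simps)
  hence unitQ: "qfact Q Q k \<noteq> 0" "inverse (qfact Q Q k) \<in> ?I 0" if "k < n" for k
    using qfact_qvar_unit[OF n, of k "int d" d] that unfolding Q by auto
  have "\<not> int n dvd - int (d * N) + int d * int i" if "i < N" for i
  proof -
    have "- int (d * N) + int d * int i = - (int d * int (N - i))"
      using that by (simp add: of_nat_diff algebra_simps)
    thus ?thesis using small[of "N - i"] that N by simp
  qed
  hence unite: "qfact e Q N \<noteq> 0" "inverse (qfact e Q N) \<in> ?I 0"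
    using qfact_qvar_unit[OF n, of N "- int (d * N)" d] unfolding e Q by auto

  \<comment> \<open>The part of the summand untouched by the deformation.\<close>
  define R where "R k = qfact b Q k * Q ^ k / qfact Q Q k ^ 3" for k
  have R: "R k \<in> ?I 0" if "k < n" for k
    unfolding R_def divide_inverse power_inverse[symmetric] using unitQ(2)[OF that] pow
    by (intro loc_ideal_mult_left loc_ideal_power loc_ideal_qfact) (simp_all add: b_def Q_def)
  have "1 - u \<in> ?I 1"
    using one_minus_qvar_powi_in_loc_ideal[OF n, of "int (t * n)"] by (simp add: u_def del: of_nat_mult)
  moreover have "inverse u \<in> ?I 0"
    using qvar_powi_in_loc_ideal[OF n, of "- int (t * n)"]
    by (simp add: u_def power_int_minus del: of_nat_mult)
  ultimately have "qfact (qvar ^ r) Q k ^ 2 - qfact a Q k * qfact e Q k \<in> ?I 2" for k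
    unfolding a_def e' using nz pow by (intro qfact_square_cong) (auto simp: Q_def u_def)
  hence diff: "(\<Sum>k = 0..n - 1. (qfact (qvar ^ r) Q k ^ 2 - qfact a Q k * qfact e Q k) * R k) \<in> ?I 2"
    using R n by (intro loc_ideal_sum loc_ideal_mult_right) auto

  \<comment> \<open>The factor at index \<open>N\<close> is zero, which truncates the deformed
    sum.\<close>
  have vanish: "qfact e Q k = 0" if "N < k" for k
    unfolding qfact_def using that nz by (auto simp: e_def intro!: bexI[of _ N])
  \<comment> \<open>Both lower parameters of the series turn out to be \<open>Q\<close>, which
    explains the cube in the denominator.\<close>
  have c: "Q = a * b * e"
  proof -
    have "a * b = Q * Q ^ N"
      using r by (simp add: a_def b_def u_def Q_def t add.commute flip: power_add power_mult)
    thus ?thesis using nz by (simp add: e_def)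
  qed
  have d: "Q = Q / (Q ^ N * e)"
    using nz by (simp add: e_def)
  have "(\<Sum>k = 0..n - 1. qfact a Q k * qfact e Q k * R k) = (\<Sum>k\<le>N. qfact a Q k * qfact e Q k * R k)"
    using N by (intro sum.mono_neutral_right) (auto simp: vanish)
  also have "\<dots> = (\<Sum>k\<le>N. qfact a Q k * qfact b Q k * qfact (inverse (Q ^ N)) Q k * Q ^ k
                 / (qfact Q Q k * qfact Q Q k * qfact Q Q k))"
    by (simp add: R_def power3_eq_cube mult_ac flip: e_def)
  also have "\<dots> = qfact (a * e) Q N * qfact (b * e) Q N / (qfact Q Q N * qfact e Q N)"
    by (rule q_saalschuetz[OF nz(1,3) c d unitQ(1)[OF N(1)] unitQ(1)[OF N(1)] unite(1)])
  also have "\<dots> = qfact (a * e) Q N * qfact (b * e) Q N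
      * (inverse (qfact Q Q N) * inverse (qfact e Q N))"
    by (simp add: field_simps)
  also have "\<dots> \<in> ?I 2"
  proof (rule loc_ideal_mult_right)
    \<comment> \<open>Substituting \<open>t * n = r + d * N\<close> shows that the exponents at the
      two chosen indices are multiples of \<open>n\<close>.\<close>
    have "int (2 * r) + int d * int (2 * N - n) = (2 * int t - int d) * int n"
      using N arg_cong[OF t, of int] by (simp add: of_nat_diff algebra_simps)
    hence "qfact (a * e) Q N \<in> ?I 1"
      unfolding ae Q_def using N by (intro qfact_qvar_in_loc_ideal[OF n, of "2 * N - n"]) auto
    moreover have "int d - 2 * int r - int d * int N + int d * int (n - Suc N) = (int d - 2 * int t) * int n"
      using N arg_cong[OF t, of int] by (simp add: of_nat_diff algebra_simps)
    hence "qfact (b * e) Q N \<in> ?I 1"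
      unfolding be Q_def using N by (intro qfact_qvar_in_loc_ideal[OF n, of "n - Suc N"]) auto
    ultimately show "qfact (a * e) Q N * qfact (b * e) Q N \<in> ?I 2"
      using loc_ideal_mult[of _ "cyclotomic n" 1 _ 1] by (simp add: numeral_2_eq_2)
    show "inverse (qfact Q Q N) * inverse (qfact e Q N) \<in> ?I 0"
      using unitQ(2)[OF N(1)] unite(2) by (rule loc_ideal_mult_left)
  qed
  finally have "(\<Sum>k = 0..n - 1. qfact a Q k * qfact e Q k * R k) \<in> ?I 2" .
  from loc_ideal_add[OF diff this]
  have "(\<Sum>k = 0..n - 1. qfact (qvar ^ r) Q k ^ 2 * R k) \<in> ?I 2"
    by (simp add: algebra_simps flip: sum.distrib)
  thus "(\<Sum>k = 0..n - 1. qfact (qvar ^ r) (qvar ^ d) k ^ 2 * qfact (qvar ^ (d - 2 * r)) (qvar ^ d) k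
        * qvar ^ (d * k) / qfact (qvar ^ d) (qvar ^ d) k ^ 3) \<in> ?I 2"
    by (simp add: R_def Q_def b_def power_mult mult.assoc)
qed

section \<open>The residue classes modulo 9\<close>

lemma coprime_9I:
  fixes n :: nat
  assumes "t * n = r + 9 * N" "\<not> 3 dvd r"
  shows "coprime n 9"
proof -
  have "\<not> 3 dvd n"
  proof
    assume "3 dvd n"
    hence "3 dvd r + 9 * N" by (simp flip: assms(1))
    thus False using assms(2) by presburger
  qed
  hence "coprime 3 n" by (intro prime_imp_coprime) auto
  hence "coprime (3 ^ 2) n" by (simp only: coprime_power_left_iff) simp
  thus ?thesis by (simp add: coprime_commute)
qed

theorem theorem5p1:
  fixes n :: nat
  assumes "n > 0"
  shows "(n mod 9 = 2 \<or> n mod 9 = 8 \<longrightarrow>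
            ratfun_cong
              (\<Sum>k = 0..n - 1.
                 qfact qvar (qvar ^ 9) k ^ 2 * qfact (qvar ^ 7) (qvar ^ 9) k * qvar ^ (9 * k)
                   / qfact (qvar ^ 9) (qvar ^ 9) k ^ 3)
              0 (cyclotomic n ^ 2)) \<and>
         (n mod 9 = 4 \<or> n mod 9 = 7 \<longrightarrow>
            ratfun_cong
              (\<Sum>k = 0..n - 1.
                 qfact (qvar ^ 2) (qvar ^ 9) k ^ 2 * qfact (qvar ^ 5) (qvar ^ 9) k * qvar ^ (9 * k)
                   / qfact (qvar ^ 9) (qvar ^ 9) k ^ 3)
              0 (cyclotomic n ^ 2)) \<and>
         (n mod 9 = 5 \<or> n mod 9 = 8 \<longrightarrow>
            ratfun_cong
              (\<Sum>k = 0..n - 1.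
                 qfact (qvar ^ 4) (qvar ^ 9) k ^ 2 * qfact qvar (qvar ^ 9) k * qvar ^ (9 * k)
                   / qfact (qvar ^ 9) (qvar ^ 9) k ^ 3)
              0 (cyclotomic n ^ 2))"
proof (intro conjI impI)
  note cong = ratfun_cong_sum_qfact[where d = 9, OF assms]
  assume "n mod 9 = 2 \<or> n mod 9 = 8"
  \<comment> \<open>\<open>t\<close> solves \<open>t * n\<close> congruent to 1 modulo 9. Since
    \<open>t < 9\<close>, \<open>N < n\<close>; the other bound amounts to
    \<open>2 * r \<le> (2 * t - 9) * n\<close> with \<open>r = 1\<close>, an equality for
    \<open>t = 5\<close> and \<open>n = 2\<close>.\<close>
  then obtain t N where "t * n = 1 + 9 * N" "N < n" "n \<le> 2 * N"
  proof
    assume "n mod 9 = 2"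
    then obtain m where "n = 9 * m + 2" by (metis mult_div_mod_eq)
    thus ?thesis by (intro that[of 5 "5 * m + 1"]) simp_all
  next
    assume "n mod 9 = 8"
    then obtain m where "n = 9 * m + 8" by (metis mult_div_mod_eq)
    thus ?thesis by (intro that[of 8 "8 * m + 7"]) simp_all
  qed
  thus "ratfun_cong
              (\<Sum>k = 0..n - 1.
                 qfact qvar (qvar ^ 9) k ^ 2 * qfact (qvar ^ 7) (qvar ^ 9) k * qvar ^ (9 * k)
                   / qfact (qvar ^ 9) (qvar ^ 9) k ^ 3)
              0 (cyclotomic n ^ 2)"
    using cong[of t 1 N] coprime_9I[of t n 1 N] by simp
next
  note cong = ratfun_cong_sum_qfact[where d = 9, OF assms]
  assume "n mod 9 = 4 \<or> n mod 9 = 7"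
  \<comment> \<open>Here 5 * 4 and 8 * 7 are congruent to 2 modulo 9.\<close>
  then obtain t N where "t * n = 2 + 9 * N" "N < n" "n \<le> 2 * N"
  proof
    assume "n mod 9 = 4"
    then obtain m where "n = 9 * m + 4" by (metis mult_div_mod_eq)
    thus ?thesis by (intro that[of 5 "5 * m + 2"]) simp_all
  next
    assume "n mod 9 = 7"
    then obtain m where "n = 9 * m + 7" by (metis mult_div_mod_eq)
    thus ?thesis by (intro that[of 8 "8 * m + 6"]) simp_all
  qed
  thus "ratfun_cong
              (\<Sum>k = 0..n - 1.
                 qfact (qvar ^ 2) (qvar ^ 9) k ^ 2 * qfact (qvar ^ 5) (qvar ^ 9) k * qvar ^ (9 * k)
                   / qfact (qvar ^ 9) (qvar ^ 9) k ^ 3)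
              0 (cyclotomic n ^ 2)"
    using cong[of t 2 N] coprime_9I[of t n 2 N] by simp
next
  note cong = ratfun_cong_sum_qfact[where d = 9, OF assms]
  assume "n mod 9 = 5 \<or> n mod 9 = 8"
  \<comment> \<open>Here 8 * 5 and 5 * 8 are congruent to 4 modulo 9.\<close>
  then obtain t N where "t * n = 4 + 9 * N" "N < n" "n \<le> 2 * N"
  proof
    assume "n mod 9 = 5"
    then obtain m where "n = 9 * m + 5" by (metis mult_div_mod_eq)
    thus ?thesis by (intro that[of 8 "8 * m + 4"]) simp_all
  next
    assume "n mod 9 = 8"
    then obtain m where "n = 9 * m + 8" by (metis mult_div_mod_eq)
    thus ?thesis by (intro that[of 5 "5 * m + 4"]) simp_all
  qed
  thus "ratfun_cong
              (\<Sum>k = 0..n - 1.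
                 qfact (qvar ^ 4) (qvar ^ 9) k ^ 2 * qfact qvar (qvar ^ 9) k * qvar ^ (9 * k)
                   / qfact (qvar ^ 9) (qvar ^ 9) k ^ 3)
              0 (cyclotomic n ^ 2)"
    using cong[of t 4 N] coprime_9I[of t n 4 N] by simp
qed

end
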